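(* There exist a constant $c>0$ and an infinite family of finite claw-free graphs $G$, with the number of vertices $n=|V(G)|$ unbounded over the family, such that $\chi_{ON}(G)\ge c\log n$ for every $G$ in the family; that is, there exist claw-free graphs $G$ on $n$ vertices with $\chi_{ON}(G)=\Omega(\log n)$.
   Context: For a graph $G$ and $v\in V(G)$, $N_G(v)$ denotes the open neighborhood of $v$. A CFON coloring of $G$ is an assignment of colors to $V(G)$ such that for every vertex $v$, some color appears exactly once among the vertices of $N_G(v)$; $\chi_{ON}(G)$ is the minimum number of colors in such a coloring. A graph is claw-free if it contains no induced subgraph isomorphic to $K_{1,3}$. *)

theory Defs
  imports Complex_Main "Graph_Theory.Graph_Theory"
begin

text \<open>
  A finite simple graph is a symmetric loop-free digraph given by a finite set of vertices and a
  set of ordered pairs (locale \<open>pair_graph\<close>); an edge \<open>uv\<close> is the pair of arcs \<open>(u, v)\<close>, \<open>(v, u)\<close>.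
\<close>

definition open_nbhd :: "'a pair_pre_digraph \<Rightarrow> 'a \<Rightarrow> 'a set" where
  "open_nbhd G v = {u. (v, u) \<in> parcs G}"

text \<open>\<open>K\<^bsub>1,3\<^esub> H\<close> is a predicate, satisfied exactly by the graphs isomorphic to the claw.\<close>

definition claw_free :: "'a pair_pre_digraph \<Rightarrow> bool" where
  "claw_free G \<longleftrightarrow> \<not> (\<exists>H. induced_subgraph H (with_proj G) \<and> K\<^bsub>1,3\<^esub> H)"

definition cfon_coloring :: "'a pair_pre_digraph \<Rightarrow> ('a \<Rightarrow> nat) \<Rightarrow> bool" where
  "cfon_coloring G f \<longleftrightarrow>
     (\<forall>v \<in> pverts G. \<exists>c. card {u \<in> open_nbhd G v. f u = c} = 1)"

definition chi_ON :: "'a pair_pre_digraph \<Rightarrow> nat" where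
  "chi_ON G = (LEAST k. \<exists>f. cfon_coloring G f \<and> card (f ` pverts G) = k)"

definition no_isolated_vertices :: "'a pair_pre_digraph \<Rightarrow> bool" where
  "no_isolated_vertices G \<longleftrightarrow> (\<forall>v \<in> pverts G. open_nbhd G v \<noteq> {})"

text \<open>
  A vertex with empty open neighborhood rules out every CFON coloring, so \<^const>\<open>chi_ON\<close> is
  meaningful only without isolated vertices. In that case the minimum is attained:
\<close>

lemma chi_ON_attained:
  assumes "pair_graph G" and "no_isolated_vertices G"
  shows "\<exists>f. cfon_coloring G f \<and> card (f ` pverts G) = chi_ON G"
proof -
  interpret pair_graph G by fact
  obtain f :: "'a \<Rightarrow> nat" where f: "inj_on f (pverts G)"
    using finite_imp_inj_to_nat_seg[OF pair_finite_verts] by blast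
  have "cfon_coloring G f"
    unfolding cfon_coloring_def
  proof
    fix v assume "v \<in> pverts G"
    then obtain w where w: "w \<in> open_nbhd G v"
      using assms(2) unfolding no_isolated_vertices_def by blast
    have "open_nbhd G v \<subseteq> pverts G"
      unfolding open_nbhd_def using in_arcsD2 by blast
    then have "{u \<in> open_nbhd G v. f u = f w} = {w}"
      using w f by (auto dest: inj_onD)
    then show "\<exists>c. card {u \<in> open_nbhd G v. f u = c} = 1"
      by (intro exI[of _ "f w"]) simp
  qed
  then have "\<exists>k g. cfon_coloring G g \<and> card (g ` pverts G) = k" by blast
  then show ?thesis unfolding chi_ON_def by (rule LeastI_ex)
qed

end

(* The family consists of the line graphs of the complete graphs K_m. Fix a CFON coloring and let
   d_c(u) be the number of edges of color c at the vertex u of K_m. The number of edges of color c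
   adjacent to an edge uv is d_c(u) + d_c(v), or two less if uv itself has color c. Some color
   makes this number 1, so the parities of d_c(u) and d_c(v) differ for some c. Thus
   the map sending u to its set of colors of odd multiplicity is injective, and m <= 2^k when
   k colors are used. *)

theory Submission
  imports Defs "HOL-Library.Nat_Bijection"
begin

text \<open>An induced claw has a center \<open>u\<close> and three leaves. An induced subgraph
  inherits every arc of \<open>G\<close> between two leaves, whereas the bipartite claw has none.
  This reduces claw-freeness to a condition on arcs of \<open>G\<close>.\<close>

lemma claw_freeI:
  assumes "\<And>u x y z. \<lbrakk>(u, x) \<in> parcs G; (u, y) \<in> parcs G; (u, z) \<in> parcs G; x \<noteq> y; x \<noteq> z; y \<noteq> z\<rbrakk>
    \<Longrightarrow> (x, y) \<in> parcs G \<or> (x, z) \<in> parcs G \<or> (y, z) \<in> parcs G"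
  shows "claw_free G"
  unfolding claw_free_def
proof safe
  fix H assume ind: "induced_subgraph H (with_proj G)" and claw: "K\<^bsub>1,3\<^esub> H"
  from ind have ht: "tail H = fst" "head H = snd"
    and arcs: "arcs H = {e \<in> parcs G. fst e \<in> verts H \<and> snd e \<in> verts H}"
    by (simp_all add: induced_subgraph_def subgraph_def compatible_def)
  have ends: "arcs_ends H = arcs H"
    by (simp add: arcs_ends_conv ht)
  from claw obtain U W where UW: "verts H = U \<union> W" "U \<inter> W = {}" "card U = 1" "card W = 3"
    "arcs H = U \<times> W \<union> W \<times> U"
    unfolding complete_bipartite_digraph_def ends by blast
  from UW(3) obtain u where u: "U = {u}" by (rule card_1_singletonE)
  from UW(4) obtain x y z where W: "W = {x, y, z}" and ne: "x \<noteq> y" "x \<noteq> z" "y \<noteq> z"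
    unfolding card_3_iff by blast
  have "(u, x) \<in> arcs H" "(u, y) \<in> arcs H" "(u, z) \<in> arcs H"
    unfolding UW(5) u W by auto
  then have "(x, y) \<in> parcs G \<or> (x, z) \<in> parcs G \<or> (y, z) \<in> parcs G"
    using ne assms unfolding arcs by blast
  then have "(x, y) \<in> arcs H \<or> (x, z) \<in> arcs H \<or> (y, z) \<in> arcs H"
    unfolding arcs UW(1) W by auto
  then show False
    using UW(2) unfolding UW(5) u W by auto
qed

text \<open>Finite edges are encoded as natural numbers by \<^const>\<open>set_encode\<close>.\<close>

definition line_graph :: "nat set set \<Rightarrow> nat pair_pre_digraph" where
  "line_graph E =
    \<lparr>pverts = {x. set_decode x \<in> E},
     parcs = {(x, y). set_decode x \<in> E \<and> set_decode y \<in> E \<and> x \<noteq> y \<and> set_decode x \<inter> set_decode y \<noteq> {}}\<rparr>"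

lemma pverts_line_graph: "pverts (line_graph E) = {x. set_decode x \<in> E}"
  by (simp add: line_graph_def)

lemma parcs_line_graph:
  "parcs (line_graph E) =
    {(x, y). set_decode x \<in> E \<and> set_decode y \<in> E \<and> x \<noteq> y \<and> set_decode x \<inter> set_decode y \<noteq> {}}"
  by (simp add: line_graph_def)

lemma bij_betw_set_decode_line_graph:
  assumes "\<And>e. e \<in> E \<Longrightarrow> finite e"
  shows "bij_betw set_decode (pverts (line_graph E)) E"
  by (rule bij_betw_byWitness[where f' = set_encode]) (auto simp: pverts_line_graph assms)

lemma pair_graph_line_graph:
  assumes "finite E" and "\<And>e. e \<in> E \<Longrightarrow> finite e"
  shows "pair_graph (line_graph E)"
proof -
  have fin: "finite (pverts (line_graph E))"
    using bij_betw_finite[OF bij_betw_set_decode_line_graph] assms by blast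
  have sub: "parcs (line_graph E) \<subseteq> pverts (line_graph E) \<times> pverts (line_graph E)"
    by (auto simp: pverts_line_graph parcs_line_graph)
  show ?thesis
    using fin finite_subset[OF sub] sub
    by unfold_locales (auto simp: pverts_line_graph parcs_line_graph symmetric_def intro!: symI)
qed

text \<open>Pigeonhole: three edges that all meet the two-element edge \<open>{a, b}\<close> include
  two that share \<open>a\<close> or share \<open>b\<close>.\<close>

lemma claw_free_line_graph:
  assumes "\<And>e. e \<in> E \<Longrightarrow> card e = 2"
  shows "claw_free (line_graph E)"
proof (rule claw_freeI)
  fix u x y z
  assume arcs: "(u, x) \<in> parcs (line_graph E)" "(u, y) \<in> parcs (line_graph E)"
    "(u, z) \<in> parcs (line_graph E)" and ne: "x \<noteq> y" "x \<noteq> z" "y \<noteq> z"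
  obtain a b where "set_decode u = {a, b}"
    using arcs(1) assms[of "set_decode u"] by (auto simp: parcs_line_graph card_2_iff)
  then show "(x, y) \<in> parcs (line_graph E) \<or> (x, z) \<in> parcs (line_graph E) \<or> (y, z) \<in> parcs (line_graph E)"
    using arcs ne unfolding parcs_line_graph by auto
qed

text \<open>The size of \<open>D c v\<close> is the degree of \<open>v\<close> in color
  \<open>c\<close>. The parity count is inclusion-exclusion on \<open>D c u\<close> and
  \<open>D c v\<close>, and it works for every finite simple graph with edge set
  \<open>E\<close>.\<close>

lemma even_colored_nbhd_line_graph:
  fixes E :: "nat set set" and f :: "nat \<Rightarrow> nat"
  defines "D \<equiv> \<lambda>c v. {y. set_decode y \<in> E \<and> f y = c \<and> v \<in> set_decode y}"
  assumes fin: "finite E" and two: "\<And>e. e \<in> E \<Longrightarrow> card e = 2"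
    and x: "set_decode x \<in> E" "set_decode x = {u, v}" "u \<noteq> v"
  shows "even (card {y \<in> open_nbhd (line_graph E) x. f y = c}) \<longleftrightarrow>
    (even (card (D c u)) \<longleftrightarrow> even (card (D c v)))"
proof -
  let ?N = "{y \<in> open_nbhd (line_graph E) x. f y = c}"
  have "finite e" if "e \<in> E" for e
    using two[OF that] by (simp add: card_ge_0_finite)
  then have "finite (pverts (line_graph E))"
    using bij_betw_finite[OF bij_betw_set_decode_line_graph] fin by blast
  then have finD: "finite (D c w)" for w
    by (rule rev_finite_subset) (auto simp: D_def pverts_line_graph)
  have N: "?N = (D c u \<union> D c v) - {x}"
    using x by (auto simp: open_nbhd_def parcs_line_graph D_def)
  \<comment> \<open>There are no parallel edges: a two-element set containing \<open>u\<close> and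
    \<open>v\<close> is \<open>{u, v}\<close>, and \<open>set_decode\<close> is injective.\<close>
  have "y = x" if "y \<in> D c u" "y \<in> D c v" for y
  proof -
    have "card (set_decode y) = 2" and "{u, v} \<subseteq> set_decode y"
      using that two by (auto simp: D_def)
    then have "set_decode y = set_decode x"
      using x by (metis card_2_iff card_subset_eq finite_set_decode)
    then show ?thesis by (metis set_decode_inverse)
  qed
  then have I: "D c u \<inter> D c v = (if f x = c then {x} else {})"
    using x by (auto simp: D_def)
  have sum: "card (D c u) + card (D c v) = card (D c u \<union> D c v) + card (D c u \<inter> D c v)"
    using finD by (rule card_Un_Int) (rule finD)
  \<comment> \<open>If \<open>x\<close> has color \<open>c\<close>, it is counted at both of its
    ends but is not its own neighbor; hence the correction by 2, which leaves the parity
    unchanged.\<close>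
  have "card (D c u) + card (D c v) = card ?N + (if f x = c then 2 else 0)"
  proof (cases "f x = c")
    case True
    then have "x \<in> D c u \<union> D c v" using x by (simp add: D_def)
    then have "card (D c u \<union> D c v) = Suc (card ?N)"
      unfolding N using finD by (metis card.remove finite_UnI)
    then show ?thesis using sum I True by simp
  next
    case False
    then have "x \<notin> D c u \<union> D c v" by (simp add: D_def)
    then show ?thesis using sum I False N by simp
  qed
  then have "even (card (D c u) + card (D c v)) \<longleftrightarrow> even (card ?N)" by simp
  then show ?thesis by auto
qed

definition complete_edges :: "nat \<Rightarrow> nat set set" where
  "complete_edges m = {e. e \<subseteq> {..<m} \<and> card e = 2}"

lemma finite_complete_edges: "finite (complete_edges m)"
  unfolding complete_edges_def by (rule finite_subset[of _ "Pow {..<m}"]) auto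

lemma complete_edgesD:
  assumes "e \<in> complete_edges m"
  shows "card e = 2" "finite e" "e \<subseteq> {..<m}"
  using assms unfolding complete_edges_def by (auto intro: finite_subset)

lemma pair_graph_line_complete: "pair_graph (line_graph (complete_edges m))"
  by (rule pair_graph_line_graph) (auto intro: finite_complete_edges complete_edgesD)

lemma card_line_complete: "card (pverts (line_graph (complete_edges m))) = m choose 2"
proof -
  have "card (pverts (line_graph (complete_edges m))) = card (complete_edges m)"
    by (rule bij_betw_same_card[OF bij_betw_set_decode_line_graph]) (rule complete_edgesD)
  also have "\<dots> = m choose 2"
    unfolding complete_edges_def using n_subsets[of "{..<m}" 2] by simp
  finally show ?thesis .
qed

text \<open>A third vertex \<open>w\<close> gives the edge \<open>{u, w}\<close> adjacent to
  \<open>{u, v}\<close>. For \<open>m = 2\<close> the only edge would be isolated.\<close>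

lemma no_isolated_vertices_line_complete:
  assumes "3 \<le> m"
  shows "no_isolated_vertices (line_graph (complete_edges m))"
  unfolding no_isolated_vertices_def
proof
  fix x assume "x \<in> pverts (line_graph (complete_edges m))"
  then have x: "set_decode x \<in> complete_edges m" by (simp add: pverts_line_graph)
  then obtain u v where uv: "set_decode x = {u, v}" "u \<noteq> v"
    using complete_edgesD(1) by (metis card_2_iff)
  have "card {u, v} < card {..<m}" using assms uv by simp
  then obtain w where w: "w < m" "w \<notin> {u, v}"
    by (metis card_mono finite.emptyI finite.insertI lessThan_iff not_le subsetI)
  have "{u, w} \<in> complete_edges m"
    using w complete_edgesD(3)[OF x] uv by (auto simp: complete_edges_def)
  moreover have "x \<noteq> set_encode {u, w}"
    using w uv by (metis finite.emptyI finite.insertI insertCI set_encode_inverse)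
  ultimately have "set_encode {u, w} \<in> open_nbhd (line_graph (complete_edges m)) x"
    using x uv by (simp add: open_nbhd_def parcs_line_graph)
  then show "open_nbhd (line_graph (complete_edges m)) x \<noteq> {}" by blast
qed

text \<open>Completeness enters because any two distinct vertices span an edge, and the coloring
  condition at that edge separates their parity sets.\<close>

lemma cfon_coloring_line_complete_bound:
  assumes cf: "cfon_coloring (line_graph (complete_edges m)) f"
  shows "m \<le> 2 ^ card (f ` pverts (line_graph (complete_edges m)))"
proof -
  let ?G = "line_graph (complete_edges m)"
  define D where "D c v = {y. set_decode y \<in> complete_edges m \<and> f y = c \<and> v \<in> set_decode y}" for c v
  define S where "S v = {c \<in> f ` pverts ?G. odd (card (D c v))}" for v
  have fin: "finite (f ` pverts ?G)"
    using pair_fin_digraph.pair_finite_verts[of ?G] pair_graph_line_complete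
    by (simp add: pair_graph_def pair_digraph_def)
  have "inj_on S {..<m}"
  proof (rule inj_onI, rule ccontr)
    fix u v assume uv: "u \<in> {..<m}" "v \<in> {..<m}" "S u = S v" "u \<noteq> v"
    define x where "x = set_encode {u, v}"
    have x: "set_decode x = {u, v}"
      unfolding x_def by (rule set_encode_inverse) simp
    have xE: "set_decode x \<in> complete_edges m"
      using uv by (simp add: x complete_edges_def)
    then obtain c where c: "card {y \<in> open_nbhd ?G x. f y = c} = 1"
      using cf unfolding cfon_coloring_def pverts_line_graph by blast
    \<comment> \<open>The color \<open>c\<close> is so far an arbitrary number. Some neighbor of
      \<open>x\<close> carries it, so it is in use and \<open>S u = S v\<close> applies to
      it.\<close>
    then have "{y \<in> open_nbhd ?G x. f y = c} \<noteq> {}"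
      by (metis card.empty zero_neq_one)
    then obtain y where "y \<in> open_nbhd ?G x" "f y = c"
      by blast
    then have "c \<in> f ` pverts ?G"
      by (auto simp: open_nbhd_def parcs_line_graph pverts_line_graph)
    then have "odd (card (D c u)) \<longleftrightarrow> odd (card (D c v))"
      using uv(3) unfolding S_def by blast
    \<comment> \<open>The count for \<open>c\<close> is 1, hence odd, so the two color degrees have
      different parities.\<close>
    then show False
      using even_colored_nbhd_line_graph[where f = f and c = c,
          OF finite_complete_edges complete_edgesD(1) xE x uv(4), folded D_def] c
      by simp
  qed
  moreover have "S ` {..<m} \<subseteq> Pow (f ` pverts ?G)" by (auto simp: S_def)
  ultimately have "card {..<m} \<le> card (Pow (f ` pverts ?G))"
    using fin by (intro card_inj_on_le) auto
  then show ?thesis using fin by (simp add: card_Pow)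
qed

text \<open>The factor 2 comes from bounding \<open>m choose 2\<close> by \<open>m ^ 2\<close>; the
  factor \<open>ln 2\<close> is dropped since it is below 1.\<close>

lemma chi_ON_line_complete_bound:
  assumes "3 \<le> m"
  shows "ln (real (card (pverts (line_graph (complete_edges m))))) \<le> 2 * real (chi_ON (line_graph (complete_edges m)))"
proof -
  let ?k = "chi_ON (line_graph (complete_edges m))"
  have "m \<le> 2 ^ ?k"
    using chi_ON_attained[OF pair_graph_line_complete no_isolated_vertices_line_complete[OF assms]]
      cfon_coloring_line_complete_bound by metis
  then have "real m \<le> 2 ^ ?k" by (metis of_nat_le_iff of_nat_numeral of_nat_power)
  then have "ln (real m) \<le> ln (2 ^ ?k)" using assms by (subst ln_le_cancel_iff) auto
  also have "\<dots> = real ?k * ln 2" by (simp add: ln_realpow)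
  also have "\<dots> \<le> real ?k * 1" using ln_2_less_1 by (intro mult_left_mono) auto
  finally have *: "ln (real m) \<le> real ?k" by simp
  have "0 < m choose 2" using assms by (simp add: zero_less_binomial_iff)
  moreover have "m choose 2 \<le> m ^ 2" using assms by (intro binomial_le_pow) simp
  ultimately have "ln (real (m choose 2)) \<le> ln (real m ^ 2)"
    using assms by (subst ln_le_cancel_iff) (auto simp flip: of_nat_power)
  also have "\<dots> = 2 * ln (real m)" using assms by (simp add: ln_realpow)
  finally show ?thesis using * by (simp add: card_line_complete)
qed

theorem theorem4:
  shows "\<exists>(c::real) (F :: nat pair_pre_digraph set).
           c > 0 \<and> infinite F \<and>
           (\<forall>G \<in> F. pair_graph G \<and> no_isolated_vertices G \<and> claw_free G) \<and>
           (\<forall>N. \<exists>G \<in> F. card (pverts G) \<ge> N) \<and>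
           (\<forall>G \<in> F. real (chi_ON G) \<ge> c * ln (real (card (pverts G))))"
proof -
  define F where "F = (\<lambda>m. line_graph (complete_edges m)) ` {3..}"
  have unbounded: "\<exists>G \<in> F. card (pverts G) \<ge> N" for N
  proof
    \<comment> \<open>The shift by 3 keeps the index in the range of the family and gives at least
      \<open>N\<close> edges.\<close>
    show "line_graph (complete_edges (N + 3)) \<in> F" by (simp add: F_def)
    have "N * 2 \<le> (N + 3) * (N + 3 - 1)" by (intro mult_mono) auto
    then have "N \<le> (N + 3) * (N + 3 - 1) div 2" by (simp only: less_eq_div_iff_mult_less_eq)
    then show "N \<le> card (pverts (line_graph (complete_edges (N + 3))))"
      unfolding card_line_complete choose_two .
  qed
  \<comment> \<open>A finite family would have bounded orders; this avoids showing that different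
    \<open>m\<close> give different graphs.\<close>
  have "infinite F"
  proof
    assume "finite F"
    then have "\<forall>G \<in> F. card (pverts G) \<le> Max ((\<lambda>G. card (pverts G)) ` F)" by simp
    then show False using unbounded[of "Suc (Max ((\<lambda>G. card (pverts G)) ` F))"] by fastforce
  qed
  moreover have "\<forall>G \<in> F. pair_graph G \<and> no_isolated_vertices G \<and> claw_free G"
    by (auto simp: F_def pair_graph_line_complete no_isolated_vertices_line_complete
        intro: claw_free_line_graph complete_edgesD)
  moreover have "\<forall>G \<in> F. real (chi_ON G) \<ge> 1/2 * ln (real (card (pverts G)))"
    using chi_ON_line_complete_bound by (fastforce simp: F_def)
  ultimately show ?thesis
    using unbounded by (intro exI[of _ "1/2"] exI[of _ F]) simp
qed

end
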